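(* Consider the online allocation problem and Algorithm 1 described in the context, run with step-size $\eta\ge0$, initial dual solution $\mu_1\in\mathbb{R}^m_+$ and reference function $h$. Suppose Assumption 1 and Assumption 2 hold and the requests are chosen by an adversary (arbitrarily). Let $\alpha^*=\max\{\sup_{(f,b,\mathcal X)\in\mathcal S}\sup_{j\in[m],x\in\mathcal X}b_j(x)/\rho_j,\ 1\}$. Then for every $T\ge1$ and every input $\vec\gamma\in\mathcal S^T$, $$\mathrm{OPT}(\vec\gamma)-\alpha^*R(A\mid\vec\gamma)\le C_1+C_2\eta T+\frac{C_3}{\eta},$$ where $C_1=\bar f\bar b/\underline\rho$, $C_2=\alpha^*(\bar b+\bar\rho)^2/(2\sigma)$, and $C_3=\max\{\alpha^*V_h(\mu,\mu_1):\ \alpha^*\mu\in\{0,(\bar f/\rho_1)e_1,\ldots,(\bar f/\rho_m)e_m\}\}$, with $e_j$ the $j$-th unit vector.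
   Context: Online allocation problem: horizon $T\ge1$, $m\ge1$ resources, dimension $d\ge1$. A request is a triple $\gamma=(f,b,\mathcal{X})$ with $\mathcal{X}\subset\mathbb{R}^d_+$ compact, $0\in\mathcal{X}$, $f:\mathcal{X}\to\mathbb{R}_+$, $b:\mathcal{X}\to\mathbb{R}^m_+$ with $b(0)=0$. $\mathcal{S}$ is the set of possible requests. A resource vector $\rho\in\mathbb{R}^m$ with all $\rho_j>0$ is given; total resources are $T\rho$. Let $\underline\rho=\min_j\rho_j$, $\bar\rho=\max_j\rho_j$. For $\vec\gamma=(\gamma_1,\dots,\gamma_T)$, $\gamma_t=(f_t,b_t,\mathcal X_t)$, $\mathrm{OPT}(\vec\gamma)=\max\{\sum_t f_t(x_t): x_t\in\mathcal X_t,\ \sum_t b_t(x_t)\le T\rho\}$. For an online algorithm $A$ choosing actions $x_t$, $R(A\mid\vec\gamma)=\sum_{t=1}^T f_t(x_t)$. Assumption 1: there exist $\bar f,\bar b\ge 0$ such that for every $(f,b,\mathcal X)\in\mathcal S$: $0\in\mathcal X$; $0\le f(x)\le\bar f$ for all $x\in\mathcal X$; $b(x)\ge0$ and $\|b(x)\|_\infty\le\bar b$ for all $x$; and for every $\mu\in\mathbb{R}^m_+$, $\max_{x\in\mathcal X}\{f(x)-\mu^\top b(x)\}$ is attained. Assumption 2: $h$ is differentiable (or essentially smooth) on $\mathbb{R}^m_+$ and $\sigma$-strongly convex w.r.t. $\|\cdot\|_1$ on $\mathbb{R}^m_+$: $h(\mu_1)\ge h(\mu_2)+\nabla h(\mu_2)^\top(\mu_1-\mu_2)+\frac\sigma2\|\mu_1-\mu_2\|_1^2$.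 Bregman divergence $V_h(x,y)=h(x)-h(y)-\nabla h(y)^\top(x-y)$. Algorithm 1: set $B_1=T\rho$. For $t=1,\dots,T$: observe $\gamma_t$; choose $\tilde x_t\in\arg\max_{x\in\mathcal X_t}\{f_t(x)-\mu_t^\top b_t(x)\}$; set $x_t=\tilde x_t$ if $b_t(\tilde x_t)\le B_t$, else $x_t=0$; $B_{t+1}=B_t-b_t(x_t)$; $\tilde g_t=\rho-b_t(\tilde x_t)$; $\mu_{t+1}=\arg\min_{\mu\in\mathbb{R}^m_+}\{\tilde g_t^\top\mu+\frac1\eta V_h(\mu,\mu_t)\}$. *)

theory Defs
  imports "HOL-Analysis.Analysis"
begin

text \<open>
  Inequalities between vectors in \<^typ>\<open>real ^ 'n\<close> are componentwise, so
  \<^term>\<open>{0..} :: (real ^ 'n) set\<close> is the nonnegative orthant.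
\<close>

section \<open>Requests and the offline optimum\<close>

text \<open>
  A request is a triple of a reward function, a resource consumption function and an action set.
  The two functions are total in the logic; only their values on the action set matter.
\<close>

type_synonym ('d, 'm) request =
  "(real ^ 'd \<Rightarrow> real) \<times> (real ^ 'd \<Rightarrow> real ^ 'm) \<times> (real ^ 'd) set"

abbreviation reward :: "('d::finite, 'm::finite) request \<Rightarrow> real ^ 'd \<Rightarrow> real" where
  "reward r \<equiv> fst r"

abbreviation consumption :: "('d::finite, 'm::finite) request \<Rightarrow> real ^ 'd \<Rightarrow> real ^ 'm" where
  "consumption r \<equiv> fst (snd r)"

abbreviation actions :: "('d::finite, 'm::finite) request \<Rightarrow> (real ^ 'd) set" where
  "actions r \<equiv> snd (snd r)"

definition valid_request :: "('d::finite, 'm::finite) request \<Rightarrow> bool" where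
  "valid_request = (\<lambda>(f, b, X).
     compact X \<and> X \<subseteq> {0..} \<and> 0 \<in> X \<and>
     (\<forall>x\<in>X. 0 \<le> f x) \<and> (\<forall>x\<in>X. 0 \<le> b x) \<and> b 0 = 0)"

definition feasible ::
  "nat \<Rightarrow> real ^ 'm \<Rightarrow> (nat \<Rightarrow> ('d::finite, 'm::finite) request) \<Rightarrow> (nat \<Rightarrow> real ^ 'd) \<Rightarrow> bool" where
  "feasible T \<rho> \<gamma> x \<longleftrightarrow>
     (\<forall>t\<in>{1..T}. x t \<in> actions (\<gamma> t)) \<and>
     (\<Sum>t=1..T. consumption (\<gamma> t) (x t)) \<le> real T *\<^sub>R \<rho>"

definition total_reward ::
  "nat \<Rightarrow> (nat \<Rightarrow> ('d::finite, 'm::finite) request) \<Rightarrow> (nat \<Rightarrow> real ^ 'd) \<Rightarrow> real" where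
  "total_reward T \<gamma> x = (\<Sum>t=1..T. reward (\<gamma> t) (x t))"

text \<open>
  The reward functions are not assumed to be upper semicontinuous, so the maximum defining the
  offline optimum need not be attained. It is rendered as a supremum, which equals the maximum
  whenever the latter exists.
\<close>

definition OPT ::
  "nat \<Rightarrow> real ^ 'm \<Rightarrow> (nat \<Rightarrow> ('d::finite, 'm::finite) request) \<Rightarrow> real" where
  "OPT T \<rho> \<gamma> = (SUP x \<in> {x. feasible T \<rho> \<gamma> x}. total_reward T \<gamma> x)"

definition bounded_requests :: "('d::finite, 'm::finite) request set \<Rightarrow> real \<Rightarrow> real \<Rightarrow> bool" where
  "bounded_requests S fbar bbar \<longleftrightarrow>
     0 \<le> fbar \<and> 0 \<le> bbar \<and>
     (\<forall>(f, b, X)\<in>S.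
        0 \<in> X \<and>
        (\<forall>x\<in>X. 0 \<le> f x \<and> f x \<le> fbar) \<and>
        (\<forall>x\<in>X. 0 \<le> b x \<and> infnorm (b x) \<le> bbar) \<and>
        (\<forall>\<mu>\<ge>0. \<exists>x. is_arg_max (\<lambda>x. f x - \<mu> \<bullet> b x) (\<lambda>x. x \<in> X) x))"

definition alpha_star :: "('d::finite, 'm::finite) request set \<Rightarrow> real ^ 'm \<Rightarrow> real" where
  "alpha_star S \<rho> =
     max (SUP (f, b, X)\<in>S. SUP (j, x)\<in>UNIV \<times> X. b x $ j / \<rho> $ j) 1"


section \<open>Reference functions\<close>

definition norm_l1 :: "real ^ 'm \<Rightarrow> real" where
  "norm_l1 v = (\<Sum>j\<in>UNIV. \<bar>v $ j\<bar>)"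

text \<open>
  Gradient relative to \<open>D\<close>: at boundary points of \<open>D\<close> only increments that stay in \<open>D\<close> are
  considered. For a convex set \<open>D\<close> with nonempty interior, such as the orthant, it is unique
  wherever it exists.
\<close>

definition gradient_on :: "(real ^ 'm) set \<Rightarrow> (real ^ 'm \<Rightarrow> real) \<Rightarrow> real ^ 'm \<Rightarrow> real ^ 'm" where
  "gradient_on D h x = (THE g. (h has_derivative (\<lambda>v. g \<bullet> v)) (at x within D))"

text \<open>Essential smoothness of a finite convex function with effective domain \<open>D\<close> (Rockafellar).\<close>

definition essentially_smooth :: "(real ^ 'm) set \<Rightarrow> (real ^ 'm \<Rightarrow> real) \<Rightarrow> bool" where
  "essentially_smooth D h \<longleftrightarrow>
     convex D \<and> convex_on D h \<and> interior D \<noteq> {} \<and>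
     (\<forall>x\<in>interior D. h differentiable (at x)) \<and>
     (\<forall>z x. (\<forall>n. z n \<in> interior D) \<and> x \<in> frontier (interior D) \<and> z \<longlonglongrightarrow> x \<longrightarrow>
        filterlim (\<lambda>n. norm (gradient_on D h (z n))) at_top sequentially)"

abbreviation grad :: "(real ^ 'm \<Rightarrow> real) \<Rightarrow> real ^ 'm \<Rightarrow> real ^ 'm" where
  "grad \<equiv> gradient_on {0..}"

text \<open>
  The domain of an essentially smooth reference function may be the orthant itself (as for the
  negative entropy) or a larger set. The strong convexity inequality is required at
  every point of the orthant where the gradient occurring in it exists; this is the whole orthant
  if \<open>h\<close> is differentiable there.
\<close>

definition reference_function :: "real \<Rightarrow> (real ^ 'm \<Rightarrow> real) \<Rightarrow> bool" where
  "reference_function \<sigma> h \<longleftrightarrow>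
     0 < \<sigma> \<and>
     (h differentiable_on {0..} \<or> (\<exists>D. {0..} \<subseteq> D \<and> essentially_smooth D h)) \<and>
     (\<forall>\<mu>1\<ge>0. \<forall>\<mu>2\<ge>0. h differentiable (at \<mu>2 within {0..}) \<longrightarrow>
        h \<mu>1 \<ge> h \<mu>2 + grad h \<mu>2 \<bullet> (\<mu>1 - \<mu>2) + \<sigma> / 2 * (norm_l1 (\<mu>1 - \<mu>2))\<^sup>2)"

definition bregman :: "(real ^ 'm \<Rightarrow> real) \<Rightarrow> real ^ 'm \<Rightarrow> real ^ 'm \<Rightarrow> real" where
  "bregman h x y = h x - h y - grad h y \<bullet> (x - y)"


section \<open>Dual mirror descent\<close>

text \<open>
  The sequences \<open>xt\<close> (tentative actions), \<open>x\<close> (actions), \<open>B\<close> (remaining resources) and \<open>\<mu>\<close>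
  (dual variables) form a run of the algorithm on input \<open>\<gamma>\<close>, for some way of breaking ties in the
  choice of \<open>xt\<close>. The dual update is stated in the extended reals so that it also makes sense for
  step size \<open>\<eta> = 0\<close>: there the weight of the divergence is \<open>\<infinity>\<close>, and with \<open>\<infinity> * 0 = 0\<close> the
  dual variable does not move.
\<close>

definition dual_mirror_descent_run ::
  "nat \<Rightarrow> real ^ 'm \<Rightarrow> (real ^ 'm \<Rightarrow> real) \<Rightarrow> real \<Rightarrow> real ^ 'm \<Rightarrow>
   (nat \<Rightarrow> ('d::finite, 'm::finite) request) \<Rightarrow>
   (nat \<Rightarrow> real ^ 'd) \<Rightarrow> (nat \<Rightarrow> real ^ 'd) \<Rightarrow> (nat \<Rightarrow> real ^ 'm) \<Rightarrow> (nat \<Rightarrow> real ^ 'm) \<Rightarrow> bool" where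
  "dual_mirror_descent_run T \<rho> h \<eta> \<mu>init \<gamma> xt x B \<mu> \<longleftrightarrow>
     B 1 = real T *\<^sub>R \<rho> \<and> \<mu> 1 = \<mu>init \<and>
     (\<forall>t\<in>{1..T}.
        is_arg_max (\<lambda>y. reward (\<gamma> t) y - \<mu> t \<bullet> consumption (\<gamma> t) y)
          (\<lambda>y. y \<in> actions (\<gamma> t)) (xt t) \<and>
        x t = (if consumption (\<gamma> t) (xt t) \<le> B t then xt t else 0) \<and>
        B (t + 1) = B t - consumption (\<gamma> t) (x t) \<and>
        is_arg_min
          (\<lambda>\<nu>. ereal ((\<rho> - consumption (\<gamma> t) (xt t)) \<bullet> \<nu>)
                 + 1 / ereal \<eta> * ereal (bregman h \<nu> (\<mu> t)))
          (\<lambda>\<nu>. 0 \<le> \<nu>) (\<mu> (t + 1)))"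

end

theory Submission
  imports Defs
begin

text \<open>
  The first-order condition for the dual update and strong convexity of \<open>h\<close> bound the regret of the
  dual variables against any fixed \<open>\<nu> \<ge> 0\<close>. If \<open>h\<close> is only essentially smooth, the condition
  still makes sense because the minimizer of the update cannot be a boundary point of the domain.

  Let \<open>\<tau>\<close> be the last time up to which the tentative consumption stays within the budget, so that
  no action is curtailed before \<open>\<tau>\<close>. Optimality of the tentative action against the action of any
  offline solution and against \<open>0\<close>, together with \<open>b \<le> \<alpha>\<^sup>* \<rho>\<close>, gives
  \<open>f\<^sub>t(y\<^sub>t) - \<alpha>\<^sup>* f\<^sub>t(x\<^sub>t) \<le> \<alpha>\<^sup>* g\<^sub>t \<bullet> \<mu>\<^sub>t\<close> for \<open>t \<le> \<tau>\<close>. The regret bound replaces \<open>\<mu>\<^sub>t\<close> by a fixed \<open>\<nu>\<close>.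
  If \<open>\<tau> = T\<close>, take \<open>\<nu> = 0\<close>; otherwise some resource \<open>j\<close> is nearly depleted at time \<open>\<tau>\<close>, and
  \<open>\<alpha>\<^sup>* \<nu> = (fbar / \<rho>\<^sub>j) e\<^sub>j\<close> pays for the reward \<open>fbar (T - \<tau>)\<close> that may be lost afterwards.
\<close>

section \<open>First-order conditions within convex sets\<close>

text \<open>The segment from \<open>z\<close> to \<open>y\<close> stays in \<open>C\<close>, so the
  chain rule along it needs only the derivative within \<open>C\<close>. This covers boundary
  points, where only one-sided quotients make sense.\<close>

lemma directional_derivative_tendsto:
  fixes h :: "'a::real_normed_vector \<Rightarrow> real"
  assumes "convex C" "z \<in> C" "y \<in> C" and der: "(h has_derivative L) (at z within C)"
  shows "((\<lambda>t. (h (z + t *\<^sub>R (y - z)) - h z) / t) \<longlongrightarrow> L (y - z)) (at_right 0)"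
proof -
  have sub: "(\<lambda>t. z + t *\<^sub>R (y - z)) ` {0..1} \<subseteq> C"
  proof clarify
    fix t :: real assume t: "t \<in> {0..1}"
    have "(1 - t) *\<^sub>R z + t *\<^sub>R y \<in> C"
      using assms t by (auto simp: convex_alt)
    then show "z + t *\<^sub>R (y - z) \<in> C" by (simp add: algebra_simps)
  qed
  have d1: "((\<lambda>t. z + t *\<^sub>R (y - z)) has_derivative (\<lambda>t. t *\<^sub>R (y - z))) (at (0::real) within {0..1})"
    by (auto intro!: derivative_eq_intros)
  have d2: "(h has_derivative L) (at (z + 0 *\<^sub>R (y - z)) within (\<lambda>t. z + t *\<^sub>R (y - z)) ` {0..1})"
    using has_derivative_subset[OF der sub] by simp
  have lin: "linear L" using der by (rule has_derivative_linear)
  have "((\<lambda>t. h (z + t *\<^sub>R (y - z))) has_derivative (\<lambda>t. L (t *\<^sub>R (y - z)))) (at (0::real) within {0..1})"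
    using has_derivative_in_compose[OF d1 d2] by simp
  moreover have "(\<lambda>t. L (t *\<^sub>R (y - z))) = (*) (L (y - z))"
    by (auto simp: linear_scale[OF lin] mult.commute)
  ultimately have "((\<lambda>t. h (z + t *\<^sub>R (y - z))) has_field_derivative L (y - z)) (at (0::real) within {0..1})"
    by (simp add: has_field_derivative_def)
  then show ?thesis
    by (simp add: has_field_derivative_iff at_within_Icc_at_right)
qed

text \<open>The difference quotients towards \<open>y\<close> are nonnegative, hence so is their
  limit. This is the variational inequality for the dual update, whose minimizer may lie on the
  boundary of the orthant.\<close>

lemma derivative_nonneg_at_minimum:
  fixes h :: "'a::real_normed_vector \<Rightarrow> real"
  assumes C: "convex C" "z \<in> C" "y \<in> C" and "(h has_derivative L) (at z within C)"
    and min: "\<And>x. x \<in> C \<Longrightarrow> h z \<le> h x"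
  shows "0 \<le> L (y - z)"
proof (rule tendsto_lowerbound[OF directional_derivative_tendsto[OF assms(1-4)]])
  show "\<forall>\<^sub>F t in at_right 0. 0 \<le> (h (z + t *\<^sub>R (y - z)) - h z) / t"
  proof (rule eventually_mono[OF eventually_at_right_real[of 0 1]])
    fix t :: real assume t: "t \<in> {0<..<1}"
    have "(1 - t) *\<^sub>R z + t *\<^sub>R y \<in> C"
      using C t by (auto simp: convex_alt)
    then have "h z \<le> h (z + t *\<^sub>R (y - z))" by (intro min) (simp add: algebra_simps)
    then show "0 \<le> (h (z + t *\<^sub>R (y - z)) - h z) / t" using t by simp
  qed simp
qed simp

text \<open>Convexity bounds every difference quotient with step in (0,1) by
  \<open>h y - h z\<close>; the bound survives in the limit.\<close>

lemma convex_on_above_tangent: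
  fixes h :: "'a::real_normed_vector \<Rightarrow> real"
  assumes conv: "convex_on C h" and C: "z \<in> C" "y \<in> C" and der: "(h has_derivative L) (at z within C)"
  shows "h z + L (y - z) \<le> h y"
proof -
  have "L (y - z) \<le> h y - h z"
  proof (rule tendsto_upperbound[OF directional_derivative_tendsto[OF _ C der]])
    show "convex C" using conv by (rule convex_on_imp_convex)
    show "\<forall>\<^sub>F t in at_right 0. (h (z + t *\<^sub>R (y - z)) - h z) / t \<le> h y - h z"
    proof (rule eventually_mono[OF eventually_at_right_real[of 0 1]])
      fix t :: real assume t: "t \<in> {0<..<1}"
      have "h ((1 - t) *\<^sub>R z + t *\<^sub>R y) \<le> (1 - t) * h z + t * h y"
        using convex_onD[OF conv, of t z y] C t by simp
      then have "h (z + t *\<^sub>R (y - z)) - h z \<le> (h y - h z) * t" by (simp add: algebra_simps)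
      then show "(h (z + t *\<^sub>R (y - z)) - h z) / t \<le> h y - h z"
        using t by (simp add: divide_le_eq)
    qed simp
  qed simp
  then show ?thesis by simp
qed

section \<open>Gradients and essential smoothness\<close>

text \<open>If \<open>D\<close> approaches \<open>x\<close> along every coordinate line, the
  derivative within \<open>D\<close> is unique, so the definite description in
  \<open>gradient_on\<close> is resolved.\<close>

lemma gradient_on_eqI:
  fixes h :: "real ^ 'm::finite \<Rightarrow> real"
  assumes "(h has_derivative (\<lambda>v. g \<bullet> v)) (at x within D)"
    and "\<And>i e. \<lbrakk>i \<in> Basis; 0 < e\<rbrakk> \<Longrightarrow> \<exists>d. 0 < \<bar>d\<bar> \<and> \<bar>d\<bar> < e \<and> x + d *\<^sub>R i \<in> D"
  shows "gradient_on D h x = g"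
  unfolding gradient_on_def
proof (rule the_equality)
  fix g' assume "(h has_derivative (\<lambda>v. g' \<bullet> v)) (at x within D)"
  then have "(\<lambda>v. g' \<bullet> v) = (\<lambda>v. g \<bullet> v)"
    using frechet_derivative_unique_within[of h _ x D] assms by blast
  then show "g' = g" by (metis vector_eq_rdot inner_commute)
qed (fact assms(1))

lemma gradient_on_has_derivative:
  fixes h :: "real ^ 'm::finite \<Rightarrow> real"
  assumes "h differentiable (at x within D)"
    and "\<And>i e. \<lbrakk>i \<in> Basis; 0 < e\<rbrakk> \<Longrightarrow> \<exists>d. 0 < \<bar>d\<bar> \<and> \<bar>d\<bar> < e \<and> x + d *\<^sub>R i \<in> D"
  shows "(h has_derivative (\<lambda>v. gradient_on D h x \<bullet> v)) (at x within D)"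
proof -
  obtain L where L: "(h has_derivative L) (at x within D)"
    using assms(1) by (auto simp: differentiable_def)
  then have lin: "linear L" by (rule has_derivative_linear)
  \<comment> \<open>Riesz representation: with the real number 1,
    \<open>L v = L v * 1 = v \<bullet> adjoint L 1\<close>.\<close>
  define g where "g = adjoint L 1"
  have "L = (\<lambda>v. g \<bullet> v)"
    using adjoint_works[OF lin, of _ 1] by (simp add: g_def inner_commute fun_eq_iff)
  with L have "(h has_derivative (\<lambda>v. g \<bullet> v)) (at x within D)" by simp
  with gradient_on_eqI[OF this assms(2)] show ?thesis by simp
qed

lemma gradient_on_interior_has_derivative:
  fixes h :: "real ^ 'm::finite \<Rightarrow> real"
  assumes "h differentiable (at x)" "x \<in> interior D"
  shows "(h has_derivative (\<lambda>v. gradient_on D h x \<bullet> v)) (at x)"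
proof -
  obtain r where r: "0 < r" "ball x r \<subseteq> D" using assms(2) mem_interior by blast
  have approach: "\<exists>d. 0 < \<bar>d\<bar> \<and> \<bar>d\<bar> < e \<and> x + d *\<^sub>R i \<in> D"
    if "i \<in> Basis" "0 < e" for i and e :: real
  proof (intro exI conjI)
    show "x + (min e r / 2) *\<^sub>R i \<in> D"
      using r that by (intro subsetD[OF r(2)]) (auto simp: dist_norm)
  qed (use r that in auto)
  have "(h has_derivative (\<lambda>v. gradient_on D h x \<bullet> v)) (at x within D)"
    by (rule gradient_on_has_derivative[OF differentiable_at_withinI[OF assms(1)] approach])
  then show ?thesis by (simp only: at_within_interior[OF assms(2)])
qed

lemma grad_has_derivative:
  fixes h :: "real ^ 'm::finite \<Rightarrow> real"
  assumes "h differentiable (at x within {0..})" "0 \<le> x"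
  shows "(h has_derivative (\<lambda>v. grad h x \<bullet> v)) (at x within {0..})"
proof (rule gradient_on_has_derivative[OF assms(1)])
  fix i :: "real ^ 'm" and e :: real assume "i \<in> Basis" "0 < e"
  \<comment> \<open>Positive steps along the axes never leave the orthant, so one side of each
    coordinate line is available even at boundary points.\<close>
  then have "0 \<le> x + (e / 2) *\<^sub>R i"
    using assms(2) by (auto simp: less_eq_vec_def Basis_vec_def axis_def)
  then show "\<exists>d. 0 < \<bar>d\<bar> \<and> \<bar>d\<bar> < e \<and> x + d *\<^sub>R i \<in> {0..}"
    using \<open>0 < e\<close> by (intro exI[of _ "e / 2"]) auto
qed

text \<open>
  Moving from \<open>x\<close> towards an interior point \<open>a\<close>, the supporting inequality bounds the directional
  derivative \<open>\<nabla>h(z) \<bullet> (a - x)\<close> from below; as \<open>h\<close> is bounded above near \<open>a\<close>, convexity then bounds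
  all of \<open>\<nabla>h(z)\<close>, which excludes the blow-up required at the boundary.
\<close>

lemma essentially_smooth_subgradient_interior:
  fixes h :: "real ^ 'm::finite \<Rightarrow> real"
  assumes es: "essentially_smooth D h" and C: "convex C" "C \<subseteq> D" "a \<in> interior C" "x \<in> C"
    and supp: "\<And>y. y \<in> C \<Longrightarrow> h x + c \<bullet> (y - x) \<le> h y"
  shows "x \<in> interior D"
proof (rule ccontr)
  assume nx: "x \<notin> interior D"
  have conv: "convex_on D h" and diff: "\<And>x. x \<in> interior D \<Longrightarrow> h differentiable (at x)"
    using es by (auto simp: essentially_smooth_def)
  define e where "e n = 1 / real (Suc n)" for n
  define z where "z n = x - e n *\<^sub>R (x - a)" for n
  define g where "g n = gradient_on D h (z n)" for n
  define k where "k = c \<bullet> (a - x)"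
  have e: "0 < e n" "e n \<le> 1" for n by (auto simp: e_def)
  have intCD: "interior C \<subseteq> interior D" using C(2) by (rule interior_mono)
  have zC: "z n \<in> interior C" for n
    unfolding z_def using mem_interior_convex_shrink[OF C(1,3,4)] e by blast
  then have zD: "z n \<in> interior D" for n using intCD by blast
  have "e \<longlonglongrightarrow> 0" unfolding e_def by (rule LIMSEQ_Suc[OF lim_1_over_n])
  then have "z \<longlonglongrightarrow> x - 0 *\<^sub>R (x - a)"
    unfolding z_def by (intro tendsto_intros)
  then have zx: "z \<longlonglongrightarrow> x" by simp
  have "x \<in> closure (interior D)"
    using zD zx closure_sequential by blast
  then have "x \<in> frontier (interior D)" using nx by (simp add: frontier_def)
  then have blow: "filterlim (\<lambda>n. norm (g n)) at_top sequentially"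
    using es zD zx unfolding essentially_smooth_def g_def by blast
  have aD: "a \<in> interior D" using C(3) intCD by blast
  have der: "(h has_derivative (\<lambda>v. g n \<bullet> v)) (at (z n) within D)" for n
    unfolding g_def
    using gradient_on_interior_has_derivative[OF diff[OF zD] zD] by (rule has_derivative_at_withinI)
  have tang: "h (z n) + g n \<bullet> (y - z n) \<le> h y" if "y \<in> D" for n y
    using convex_on_above_tangent[OF conv _ that der] zD interior_subset by blast
  have "isCont h a" using diff[OF aD] by (rule differentiable_imp_continuous_within)
  then obtain s where s: "0 < s" "\<And>y. dist y a < s \<Longrightarrow> dist (h y) (h a) < 1"
    unfolding continuous_at_eps_delta by (metis zero_less_one)
  obtain r where r: "0 < r" "ball a r \<subseteq> D" using aD mem_interior by blast
  define d where "d = min r s / 2"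
  have d: "0 < d" "d < r" "d < s" using r s by (auto simp: d_def)
  have bound: "norm (g n) \<le> (h a + 1 - h x - k) / d" if gn: "g n \<noteq> 0" for n
  proof -
    \<comment> \<open>The point at distance \<open>d\<close> from \<open>a\<close> in the direction
      of the gradient, so that pairing \<open>y - a\<close> with \<open>g n\<close> yields
      \<open>d * norm (g n)\<close>.\<close>
    define y where "y = a + (d / norm (g n)) *\<^sub>R g n"
    have dy: "dist y a = d" using d gn by (simp add: y_def dist_norm)
    then have yD: "y \<in> D" using d r(2) by (auto simp: dist_commute)
    have hy: "h y \<le> h a + 1" using s(2)[of y] dy d by (auto simp: dist_real_def)
    have zx_eq: "z n - x = e n *\<^sub>R (a - x)" by (simp add: z_def algebra_simps)
    have low: "h x + e n * k \<le> h (z n)"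
      using supp[of "z n"] zC interior_subset zx_eq by (auto simp: k_def)
    have "h (z n) + g n \<bullet> (x - z n) \<le> h x" using tang[of x n] C by blast
    moreover have "x - z n = - (e n *\<^sub>R (a - x))" using zx_eq by (simp add: algebra_simps)
    ultimately have "e n * k \<le> e n * (g n \<bullet> (a - x))" using low by simp
    then have gk: "k \<le> g n \<bullet> (a - x)" using e(1)[of n] by simp
    have "a - z n = (1 - e n) *\<^sub>R (a - x)" by (simp add: z_def algebra_simps)
    then have "(1 - e n) * k \<le> g n \<bullet> (a - z n)"
      using gk e(2)[of n] by (simp add: mult_left_mono)
    moreover have "g n \<bullet> (y - z n) \<le> h a + 1 - h x - e n * k"
      using tang[OF yD, of n] hy low by simp
    moreover have "g n \<bullet> (y - z n) = g n \<bullet> (y - a) + g n \<bullet> (a - z n)"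
      by (simp add: inner_diff_right)
    moreover have "g n \<bullet> (y - a) = d * norm (g n)"
      using gn by (simp add: y_def dot_square_norm power2_eq_square)
    \<comment> \<open>The contributions \<open>e n * k\<close> and \<open>(1 - e n) * k\<close> add
      up to \<open>k\<close>, which makes the bound independent of \<open>n\<close>.\<close>
    ultimately have "d * norm (g n) \<le> h a + 1 - h x - k" by (simp add: algebra_simps)
    then show ?thesis using d(1) by (simp add: field_simps)
  qed
  define M where "M = max 0 ((h a + 1 - h x - k) / d)"
  have "norm (g n) \<le> M" for n
    using bound[of n] by (cases "g n = 0") (auto simp: M_def)
  moreover have "\<forall>\<^sub>F n in sequentially. M < norm (g n)"
    using blow by (simp add: filterlim_at_top_dense)
  ultimately show False
    by (metis eventually_sequentially le_refl not_le)
qed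

section \<open>Mirror descent\<close>

lemma norm_l1_eq_0: "norm_l1 v = 0 \<Longrightarrow> v = 0"
  by (simp add: norm_l1_def sum_nonneg_eq_0_iff vec_eq_iff)

text \<open>Hoelder's inequality for the l1 and maximum norms. Strong convexity is measured in l1,
  so dual gradients are bounded componentwise.\<close>

lemma inner_le_norm_l1:
  fixes g v :: "real ^ 'm::finite"
  assumes "\<And>j. \<bar>g $ j\<bar> \<le> G"
  shows "g \<bullet> v \<le> G * norm_l1 v"
proof -
  have "g \<bullet> v = (\<Sum>j\<in>UNIV. g $ j * v $ j)" by (simp add: inner_vec_def)
  also have "\<dots> \<le> (\<Sum>j\<in>UNIV. G * \<bar>v $ j\<bar>)"
  proof (rule sum_mono)
    fix j
    have "g $ j * v $ j \<le> \<bar>g $ j\<bar> * \<bar>v $ j\<bar>" by (metis abs_ge_self abs_mult)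
    also have "\<dots> \<le> G * \<bar>v $ j\<bar>" by (intro mult_right_mono assms) simp
    finally show "g $ j * v $ j \<le> G * \<bar>v $ j\<bar>" .
  qed
  finally show ?thesis by (simp add: norm_l1_def sum_distrib_left)
qed

lemma bregman_ge_norm_l1:
  assumes "reference_function \<sigma> h" "0 \<le> x" "0 \<le> y" "h differentiable (at y within {0..})"
  shows "\<sigma> / 2 * (norm_l1 (x - y))\<^sup>2 \<le> bregman h x y"
  using assms unfolding reference_function_def bregman_def by (smt (verit))

lemma bregman_nonneg:
  assumes "reference_function \<sigma> h" "0 \<le> x" "0 \<le> y" "h differentiable (at y within {0..})"
  shows "0 \<le> bregman h x y"
proof -
  have "0 \<le> \<sigma> / 2 * (norm_l1 (x - y))\<^sup>2"
    using assms(1) by (simp add: reference_function_def)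
  with bregman_ge_norm_l1[OF assms] show ?thesis by linarith
qed

text \<open>Strong convexity makes the divergence dominate a positive multiple of the squared l1
  distance.\<close>

lemma bregman_eq_0:
  assumes "reference_function \<sigma> h" "0 \<le> x" "0 \<le> y" "h differentiable (at y within {0..})"
    and "bregman h x y \<le> 0"
  shows "x = y"
proof -
  have "0 < \<sigma>" using assms(1) by (simp add: reference_function_def)
  moreover have "\<sigma> / 2 * (norm_l1 (x - y))\<^sup>2 \<le> 0"
    using bregman_ge_norm_l1[OF assms(1-4)] assms(5) by linarith
  ultimately have "norm_l1 (x - y) = 0" by (simp add: mult_le_0_iff)
  then show ?thesis using norm_l1_eq_0 by force
qed

section \<open>Analysis of a single dual step and its summation over time\<close>

lemma convex_orthant: "convex {0 :: real ^ 'm::finite ..}"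
  by (auto simp: convex_def less_eq_vec_def)

lemma one_in_interior_orthant: "(1 :: real ^ 'm::finite) \<in> interior {0..}"
proof -
  have "ball 1 1 \<subseteq> {0 :: real ^ 'm ..}"
  proof
    fix y :: "real ^ 'm" assume "y \<in> ball 1 1"
    then have "norm (1 - y) < 1" by (simp add: dist_norm)
    then have "\<bar>(1 - y) $ j\<bar> < 1" for j
      using component_le_norm_cart[of "1 - y" j] by linarith
    then have "\<bar>1 - y $ j\<bar> < 1" for j by simp
    then have "0 \<le> y $ j" for j by (simp add: abs_less_iff less_imp_le)
    then show "y \<in> {0..}" by (simp add: less_eq_vec_def)
  qed
  then show ?thesis by (meson mem_interior zero_less_one)
qed

text \<open>In the essentially smooth case, minimality scaled by \<eta> says that
  \<open>grad h \<mu> - \<eta> *\<^sub>R g\<close> is a subgradient of \<open>h\<close> at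
  \<open>\<mu>'\<close> relative to the orthant. This forces \<open>\<mu>'\<close> into the interior
  of the domain, where \<open>h\<close> is differentiable.\<close>

lemma mirror_step_differentiable:
  fixes h :: "real ^ 'm::finite \<Rightarrow> real"
  assumes ref: "reference_function \<sigma> h" and "0 < \<eta>" "0 \<le> \<mu>'"
    and min: "\<And>\<nu>. 0 \<le> \<nu> \<Longrightarrow> g \<bullet> \<mu>' + bregman h \<mu>' \<mu> / \<eta> \<le> g \<bullet> \<nu> + bregman h \<nu> \<mu> / \<eta>"
  shows "h differentiable (at \<mu>' within {0..})"
proof -
  consider "h differentiable_on {0..}" | D where "{0..} \<subseteq> D" "essentially_smooth D h"
    using ref by (auto simp: reference_function_def)
  then show ?thesis
  proof cases
    case 1
    then show ?thesis using assms(3) by (simp add: differentiable_on_def)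
  next
    case 2
    have "h \<mu>' + (grad h \<mu> - \<eta> *\<^sub>R g) \<bullet> (\<nu> - \<mu>') \<le> h \<nu>" if "\<nu> \<in> {0..}" for \<nu>
    proof -
      have "\<eta> * (g \<bullet> \<mu>' + bregman h \<mu>' \<mu> / \<eta>) \<le> \<eta> * (g \<bullet> \<nu> + bregman h \<nu> \<mu> / \<eta>)"
        using min[of \<nu>] that \<open>0 < \<eta>\<close> by (intro mult_left_mono) auto
      then have "\<eta> * (g \<bullet> \<mu>') + bregman h \<mu>' \<mu> \<le> \<eta> * (g \<bullet> \<nu>) + bregman h \<nu> \<mu>"
        using \<open>0 < \<eta>\<close> by (simp add: distrib_left)
      then show ?thesis
        by (simp add: bregman_def inner_diff_left inner_diff_right algebra_simps)
    qed
    then have "\<mu>' \<in> interior D"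
      using essentially_smooth_subgradient_interior[OF 2(2) convex_orthant 2(1) one_in_interior_orthant]
        \<open>0 \<le> \<mu>'\<close> by (metis atLeast_iff)
    then have "h differentiable (at \<mu>')" using 2(2) by (simp add: essentially_smooth_def)
    then show ?thesis by (rule differentiable_at_withinI)
  qed
qed

text \<open>The first-order condition at \<open>\<mu>'\<close> and the three-point identity control
  \<open>g \<bullet> (\<mu>' - \<nu>)\<close>. The remaining
  \<open>g \<bullet> (\<mu> - \<mu>')\<close> is split by Young's inequality, and strong convexity
  absorbs its quadratic part into \<open>bregman h \<mu>' \<mu>\<close>.\<close>

lemma mirror_step_regret:
  fixes h :: "real ^ 'm::finite \<Rightarrow> real"
  assumes ref: "reference_function \<sigma> h" and "0 < \<eta>" "0 \<le> \<mu>" "0 \<le> \<mu>'" "0 \<le> \<nu>"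
    and diff: "h differentiable (at \<mu> within {0..})"
    and min: "\<And>\<nu>. 0 \<le> \<nu> \<Longrightarrow> g \<bullet> \<mu>' + bregman h \<mu>' \<mu> / \<eta> \<le> g \<bullet> \<nu> + bregman h \<nu> \<mu> / \<eta>"
    and G: "\<And>j. \<bar>g $ j\<bar> \<le> G"
  shows "g \<bullet> (\<mu> - \<nu>) \<le> \<eta> * G\<^sup>2 / (2 * \<sigma>) + (bregman h \<nu> \<mu> - bregman h \<nu> \<mu>') / \<eta>"
proof -
  have "0 < \<sigma>" using ref by (simp add: reference_function_def)
  have diff': "h differentiable (at \<mu>' within {0..})"
    using mirror_step_differentiable[OF ref \<open>0 < \<eta>\<close> \<open>0 \<le> \<mu>'\<close> min] .
  have "((\<lambda>\<nu>. g \<bullet> \<nu> + bregman h \<nu> \<mu> / \<eta>) has_derivative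
      (\<lambda>v. g \<bullet> v + (grad h \<mu>' \<bullet> v - grad h \<mu> \<bullet> v) / \<eta>)) (at \<mu>' within {0..})"
    unfolding bregman_def divide_inverse using grad_has_derivative[OF diff' \<open>0 \<le> \<mu>'\<close>]
    by (auto intro!: derivative_eq_intros)
  from derivative_nonneg_at_minimum[OF convex_orthant _ _ this, of \<nu>] min
  have opt: "0 \<le> g \<bullet> (\<nu> - \<mu>') + (grad h \<mu>' \<bullet> (\<nu> - \<mu>') - grad h \<mu> \<bullet> (\<nu> - \<mu>')) / \<eta>"
    using \<open>0 \<le> \<mu>'\<close> \<open>0 \<le> \<nu>\<close> by simp
  have three_point: "grad h \<mu>' \<bullet> (\<nu> - \<mu>') - grad h \<mu> \<bullet> (\<nu> - \<mu>')
      = bregman h \<nu> \<mu> - bregman h \<nu> \<mu>' - bregman h \<mu>' \<mu>"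
    by (simp add: bregman_def inner_diff_right)
  define N where "N = norm_l1 (\<mu> - \<mu>')"
  have N: "norm_l1 (\<mu>' - \<mu>) = N" by (simp add: N_def norm_l1_def abs_minus_commute)
  have "g \<bullet> (\<mu> - \<mu>') \<le> G * N" unfolding N_def by (rule inner_le_norm_l1[OF G])
  also have "\<dots> \<le> \<eta> * G\<^sup>2 / (2 * \<sigma>) + \<sigma> / (2 * \<eta>) * N\<^sup>2"
  proof -
    \<comment> \<open>Young's inequality by completing the square; the weights match the strong
      convexity constant divided by \<eta>.\<close>
    have "0 \<le> (\<eta> * G - \<sigma> * N)\<^sup>2 / (2 * \<sigma> * \<eta>)" using \<open>0 < \<sigma>\<close> \<open>0 < \<eta>\<close> by simp
    also have "\<dots> = \<eta> * G\<^sup>2 / (2 * \<sigma>) + \<sigma> / (2 * \<eta>) * N\<^sup>2 - G * N"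
      using \<open>0 < \<sigma>\<close> \<open>0 < \<eta>\<close> by (simp add: field_simps power2_eq_square)
    finally show ?thesis by simp
  qed
  also have "\<sigma> / (2 * \<eta>) * N\<^sup>2 \<le> bregman h \<mu>' \<mu> / \<eta>"
    using divide_right_mono[OF bregman_ge_norm_l1[OF ref \<open>0 \<le> \<mu>'\<close> \<open>0 \<le> \<mu>\<close> diff], of \<eta>] \<open>0 < \<eta>\<close> N
    by (simp add: mult.commute)
  finally have "g \<bullet> (\<mu> - \<mu>') \<le> \<eta> * G\<^sup>2 / (2 * \<sigma>) + bregman h \<mu>' \<mu> / \<eta>" by simp
  moreover have "g \<bullet> (\<mu> - \<nu>) = g \<bullet> (\<mu> - \<mu>') - g \<bullet> (\<nu> - \<mu>')"
    by (simp add: inner_diff_right)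
  ultimately show ?thesis
    using opt unfolding three_point by (simp add: diff_divide_distrib)
qed

text \<open>The divergences to \<nu> telescope over the steps, and the last one is nonnegative. The
  sum may stop at any \<open>\<tau> \<le> T\<close>, as needed for a stopping time.\<close>

lemma mirror_descent_regret:
  fixes h :: "real ^ 'm::finite \<Rightarrow> real"
  assumes ref: "reference_function \<sigma> h" and "0 < \<eta>" "0 \<le> \<mu> 1" "0 \<le> \<nu>"
    and diff: "h differentiable (at (\<mu> 1) within {0..})"
    and nonneg: "\<And>t. t \<in> {1..T} \<Longrightarrow> 0 \<le> \<mu> (t + 1)"
    and min: "\<And>t \<nu>. \<lbrakk>t \<in> {1..T}; 0 \<le> \<nu>\<rbrakk> \<Longrightarrow>
      g t \<bullet> \<mu> (t + 1) + bregman h (\<mu> (t + 1)) (\<mu> t) / \<eta> \<le> g t \<bullet> \<nu> + bregman h \<nu> (\<mu> t) / \<eta>"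
    and G: "\<And>t j. t \<in> {1..T} \<Longrightarrow> \<bar>g t $ j\<bar> \<le> G"
    and "\<tau> \<le> T"
  shows "(\<Sum>t=1..\<tau>. g t \<bullet> (\<mu> t - \<nu>)) \<le> real \<tau> * (\<eta> * G\<^sup>2 / (2 * \<sigma>)) + bregman h \<nu> (\<mu> 1) / \<eta>"
proof -
  define K where "K = \<eta> * G\<^sup>2 / (2 * \<sigma>)"
  \<comment> \<open>The case \<open>t = 0\<close> is the initial point; later iterates are
    differentiability points because they minimize an update.\<close>
  have inv: "0 \<le> \<mu> (t + 1) \<and> h differentiable (at (\<mu> (t + 1)) within {0..})" if "t \<le> T" for t
  proof (cases t)
    case 0
    then show ?thesis using assms by simp
  next
    case (Suc s)
    then have "t \<in> {1..T}" using that by simp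
    then show ?thesis
      using mirror_step_differentiable[OF ref \<open>0 < \<eta>\<close>, of "\<mu> (t + 1)" "g t" "\<mu> t"] nonneg min by blast
  qed
  have "(\<Sum>t=1..\<tau>. g t \<bullet> (\<mu> t - \<nu>))
      \<le> real \<tau> * K + (bregman h \<nu> (\<mu> 1) - bregman h \<nu> (\<mu> (\<tau> + 1))) / \<eta>"
    using \<open>\<tau> \<le> T\<close>
  proof (induction \<tau>)
    case (Suc \<tau>)
    have mem: "Suc \<tau> \<in> {1..T}" using Suc.prems by simp
    have "g (Suc \<tau>) \<bullet> (\<mu> (Suc \<tau>) - \<nu>)
        \<le> K + (bregman h \<nu> (\<mu> (Suc \<tau>)) - bregman h \<nu> (\<mu> (Suc \<tau> + 1))) / \<eta>"
      unfolding K_def using inv[of \<tau>] Suc.prems nonneg[OF mem] min[OF mem] G[OF mem] \<open>0 \<le> \<nu>\<close>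
      by (intro mirror_step_regret[OF ref \<open>0 < \<eta>\<close>]) auto
    then show ?case using Suc by (simp add: distrib_right diff_divide_distrib)
  qed simp
  moreover have "0 \<le> bregman h \<nu> (\<mu> (\<tau> + 1)) / \<eta>"
    using bregman_nonneg[OF ref \<open>0 \<le> \<nu>\<close>] inv[OF \<open>\<tau> \<le> T\<close>] \<open>0 < \<eta>\<close> by simp
  ultimately show ?thesis by (simp add: K_def diff_divide_distrib)
qed

section \<open>Comparison with the offline optimum\<close>

lemma bounded_requestsD:
  assumes "bounded_requests S fbar bbar" "r \<in> S"
  shows "0 \<in> actions r"
    and "y \<in> actions r \<Longrightarrow> 0 \<le> reward r y"
    and "y \<in> actions r \<Longrightarrow> reward r y \<le> fbar"
    and "y \<in> actions r \<Longrightarrow> 0 \<le> consumption r y $ j"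
    and "y \<in> actions r \<Longrightarrow> consumption r y $ j \<le> bbar"
proof -
  obtain f b X where r: "r = (f, b, X)" by (cases r)
  have *: "0 \<in> X \<and> (\<forall>x\<in>X. 0 \<le> f x \<and> f x \<le> fbar) \<and> (\<forall>x\<in>X. 0 \<le> b x \<and> infnorm (b x) \<le> bbar)"
    using assms unfolding bounded_requests_def r by fast
  show "0 \<in> actions r" using * r by simp
  assume y: "y \<in> actions r"
  with * r show "0 \<le> reward r y" "reward r y \<le> fbar" "0 \<le> consumption r y $ j"
    by (auto simp: less_eq_vec_def)
  have "\<bar>b y $ j\<bar> \<le> infnorm (b y)" by (rule component_le_infnorm_cart)
  with * r y show "consumption r y $ j \<le> bbar" by force
qed

lemma alpha_star_ge_1: "1 \<le> alpha_star S \<rho>"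
  by (simp add: alpha_star_def)

text \<open>Real suprema can be compared with their elements only once boundedness is known. The
  common bound \<open>M\<close> serves for the inner and the outer supremum alike.\<close>

lemma consumption_le_alpha_star:
  fixes S :: "('d::finite, 'm::finite) request set"
  assumes \<rho>: "\<forall>j. 0 < \<rho> $ j" and bounded: "bounded_requests S fbar bbar"
    and r: "r \<in> S" and y: "y \<in> actions r"
  shows "consumption r y $ j \<le> alpha_star S \<rho> * \<rho> $ j"
proof -
  define F where "F r = (SUP (j, x)\<in>UNIV \<times> actions r. consumption r x $ j / \<rho> $ j)"
    for r :: "('d, 'm) request"
  have alpha: "alpha_star S \<rho> = max (SUP r\<in>S. F r) 1"
    by (simp add: alpha_star_def F_def split_beta)
  define M where "M = bbar / Min (range (\<lambda>j. \<rho> $ j))"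
  have minpos: "0 < Min (range (\<lambda>j. \<rho> $ j))"
    using \<rho> by (subst Min_gr_iff) auto
  have "0 \<le> bbar" using bounded by (simp add: bounded_requests_def)
  then have ratio: "consumption r x $ j / \<rho> $ j \<le> M" if "r \<in> S" "x \<in> actions r" for r x j
    unfolding M_def using bounded_requestsD(5)[OF bounded that(1)] that minpos
    by (intro frac_le) auto
  have bdd: "bdd_above ((\<lambda>(j, x). consumption r x $ j / \<rho> $ j) ` (UNIV \<times> actions r))"
    if "r \<in> S" for r
    using ratio[OF that] by (intro bdd_aboveI[of _ M]) auto
  have "F r \<le> M" if "r \<in> S" for r
    unfolding F_def using bounded_requestsD(1)[OF bounded that] ratio[OF that]
    by (intro cSUP_least) auto
  then have "F r \<le> (SUP r\<in>S. F r)"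
    using r by (intro cSUP_upper bdd_aboveI[of _ M]) auto
  moreover have "consumption r y $ j / \<rho> $ j \<le> F r"
    unfolding F_def using cSUP_upper[OF _ bdd[OF r], of "(j, y)"] y by auto
  ultimately have "consumption r y $ j / \<rho> $ j \<le> alpha_star S \<rho>" by (simp add: alpha)
  then show ?thesis using \<rho> by (simp add: pos_divide_le_eq)
qed

section \<open>The stopping time and the steps before it\<close>

lemma last_before_violation:
  fixes n :: nat
  assumes "P 0"
  obtains k where "k \<le> n" "\<forall>t\<le>k. P t" "k = n \<or> \<not> P (Suc k)"
proof -
  have "\<exists>k\<le>n. (\<forall>t\<le>k. P t) \<and> (k = n \<or> \<not> P (Suc k))"
  proof (induction n)
    case 0
    show ?case using assms by auto
  next
    case (Suc n)
    then obtain k where k: "k \<le> n" "\<forall>t\<le>k. P t" "k = n \<or> \<not> P (Suc k)" by blast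
    show ?case
    proof (cases "P (Suc k)")
      case True
      with k have "\<forall>t\<le>Suc n. P t" by (auto simp: le_Suc_eq)
      then show ?thesis by blast
    next
      case False
      with k show ?thesis using le_SucI by blast
    qed
  qed
  then show ?thesis using that by blast
qed

text \<open>As long as no action has been curtailed, \<open>B\<close> is the initial budget minus
  the tentative consumption, so the test made by the algorithm is the budget condition on the next
  partial sum.\<close>

lemma run_uncurtailed:
  assumes run: "dual_mirror_descent_run T \<rho> h \<eta> \<mu>init \<gamma> xt x B \<mu>"
    and "\<tau> \<le> T"
    and within: "\<forall>t\<le>\<tau>. (\<Sum>s=1..t. consumption (\<gamma> s) (xt s)) \<le> real T *\<^sub>R \<rho>"
  shows "\<forall>t\<in>{1..\<tau>}. x t = xt t"
proof -
  have step: "B (t + 1) = real T *\<^sub>R \<rho> - (\<Sum>s=1..t. consumption (\<gamma> s) (xt s))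
      \<and> (t \<noteq> 0 \<longrightarrow> x t = xt t)" if "t \<le> \<tau>" for t
    using that
  proof (induction t)
    case 0
    show ?case using run by (simp add: dual_mirror_descent_run_def)
  next
    case (Suc t)
    have mem: "Suc t \<in> {1..T}" using Suc.prems \<open>\<tau> \<le> T\<close> by simp
    have B: "B (Suc t) = real T *\<^sub>R \<rho> - (\<Sum>s=1..t. consumption (\<gamma> s) (xt s))"
      using Suc by simp
    have "(\<Sum>s=1..Suc t. consumption (\<gamma> s) (xt s)) \<le> real T *\<^sub>R \<rho>"
      using within Suc.prems by blast
    then have "consumption (\<gamma> (Suc t)) (xt (Suc t)) \<le> B (Suc t)"
      unfolding B by (simp add: less_eq_vec_def algebra_simps)
    then have "x (Suc t) = xt (Suc t)" "B (Suc t + 1) = B (Suc t) - consumption (\<gamma> (Suc t)) (xt (Suc t))"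
      using run mem unfolding dual_mirror_descent_run_def by auto
    then show ?case using B by simp
  qed
  show ?thesis
  proof
    fix t assume "t \<in> {1..\<tau>}"
    then show "x t = xt t" using step[of t] by auto
  qed
qed

text \<open>Let v be the maximal penalized reward, attained at \<open>z\<close>. Comparison with the
  action 0 gives v \<ge> 0, so v is at most \<open>alpha_star S \<rho>\<close> times v. The penalty
  of \<open>y\<close> is at most the same factor times \<open>\<mu> \<bullet> \<rho>\<close>. Adding
  both bounds the reward of \<open>y\<close>.\<close>

lemma run_reward_ge:
  assumes \<rho>: "\<forall>j. 0 < \<rho> $ j" and bounded: "bounded_requests S fbar bbar"
    and r: "r \<in> S" and "0 \<le> \<mu>"
    and max: "is_arg_max (\<lambda>y. reward r y - \<mu> \<bullet> consumption r y) (\<lambda>y. y \<in> actions r) z"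
    and zero: "consumption r 0 = 0" and y: "y \<in> actions r"
  shows "reward r y - alpha_star S \<rho> * reward r z
      \<le> alpha_star S \<rho> * ((\<rho> - consumption r z) \<bullet> \<mu>)"
proof -
  define \<alpha> where "\<alpha> = alpha_star S \<rho>"
  have "1 \<le> \<alpha>" by (simp add: \<alpha>_def alpha_star_ge_1)
  have opt: "reward r y - \<mu> \<bullet> consumption r y \<le> reward r z - \<mu> \<bullet> consumption r z"
    if "y \<in> actions r" for y
    using max that by (auto simp: is_arg_max_linorder)
  have "0 \<le> reward r 0" "0 \<in> actions r"
    using bounded_requestsD[OF bounded r] by auto
  then have "0 \<le> reward r z - \<mu> \<bullet> consumption r z"
    using opt[of 0] zero by simp
  then have "reward r z - \<mu> \<bullet> consumption r z \<le> \<alpha> * (reward r z - \<mu> \<bullet> consumption r z)"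
    using \<open>1 \<le> \<alpha>\<close> by (simp add: mult_le_cancel_right1)
  moreover have "\<mu> \<bullet> consumption r y \<le> \<alpha> * (\<mu> \<bullet> \<rho>)"
  proof -
    have "\<mu> \<bullet> consumption r y = (\<Sum>j\<in>UNIV. \<mu> $ j * consumption r y $ j)"
      by (simp add: inner_vec_def)
    also have "\<dots> \<le> (\<Sum>j\<in>UNIV. \<mu> $ j * (\<alpha> * \<rho> $ j))"
      using \<open>0 \<le> \<mu>\<close> consumption_le_alpha_star[OF \<rho> bounded r y]
      by (intro sum_mono mult_left_mono) (auto simp: less_eq_vec_def \<alpha>_def)
    also have "\<dots> = \<alpha> * (\<mu> \<bullet> \<rho>)"
      by (simp add: inner_vec_def sum_distrib_left mult_ac)
    finally show ?thesis .
  qed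
  moreover have "(\<rho> - consumption r z) \<bullet> \<mu> = \<mu> \<bullet> \<rho> - \<mu> \<bullet> consumption r z"
    by (metis inner_commute inner_diff_right)
  ultimately show ?thesis
    using opt[OF y] unfolding \<alpha>_def[symmetric] by (simp add: right_diff_distrib)
qed

text \<open>The bound for positive step size against one fixed offline solution \<open>y\<close>;
  \<open>C3\<close> may be any upper bound for the comparator terms.\<close>

lemma run_competitive:
  fixes \<rho> :: "real ^ 'm::finite" and \<gamma> :: "nat \<Rightarrow> ('d::finite, 'm) request"
  assumes \<rho>: "\<forall>j. 0 < \<rho> $ j" and valid: "\<forall>r\<in>S. valid_request r"
    and bounded: "bounded_requests S fbar bbar" and ref: "reference_function \<sigma> h"
    and "0 < \<eta>" "0 \<le> \<mu>init" and diff: "h differentiable (at \<mu>init within {0..})"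
    and S: "\<forall>t\<in>{1..T}. \<gamma> t \<in> S"
    and run: "dual_mirror_descent_run T \<rho> h \<eta> \<mu>init \<gamma> xt x B \<mu>"
    and feas: "feasible T \<rho> \<gamma> y"
    and C3: "\<And>\<nu>. alpha_star S \<rho> *\<^sub>R \<nu> \<in> insert 0 (range (\<lambda>j. (fbar / \<rho> $ j) *\<^sub>R axis j 1))
      \<Longrightarrow> alpha_star S \<rho> * bregman h \<nu> \<mu>init \<le> C3"
  shows "total_reward T \<gamma> y - alpha_star S \<rho> * total_reward T \<gamma> x
      \<le> fbar * bbar / Min (range (\<lambda>j. \<rho> $ j))
        + alpha_star S \<rho> * (bbar + Max (range (\<lambda>j. \<rho> $ j)))\<^sup>2 / (2 * \<sigma>) * \<eta> * real T + C3 / \<eta>"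
proof -
  define \<alpha> where "\<alpha> = alpha_star S \<rho>"
  define b where "b t = consumption (\<gamma> t) (xt t)" for t
  define g where "g t = \<rho> - b t" for t
  define G where "G = bbar + Max (range (\<lambda>j. \<rho> $ j))"
  define K where "K = \<eta> * G\<^sup>2 / (2 * \<sigma>)"
  define \<rho>min where "\<rho>min = Min (range (\<lambda>j. \<rho> $ j))"
  have "0 < \<sigma>" using ref by (simp add: reference_function_def)
  have "0 \<le> fbar" "0 \<le> bbar" using bounded by (auto simp: bounded_requests_def)
  have "1 \<le> \<alpha>" by (simp add: \<alpha>_def alpha_star_ge_1)
  have "0 < \<rho>min" unfolding \<rho>min_def using \<rho> by (subst Min_gr_iff) auto
  have \<rho>min: "\<rho>min \<le> \<rho> $ j" for j unfolding \<rho>min_def by (intro Min_le) auto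
  have \<mu>1: "\<mu> 1 = \<mu>init" using run by (simp add: dual_mirror_descent_run_def)
  have steps: "is_arg_max (\<lambda>y. reward (\<gamma> t) y - \<mu> t \<bullet> consumption (\<gamma> t) y)
          (\<lambda>y. y \<in> actions (\<gamma> t)) (xt t) \<and>
        x t = (if b t \<le> B t then xt t else 0) \<and>
        is_arg_min (\<lambda>\<nu>. ereal (g t \<bullet> \<nu>) + 1 / ereal \<eta> * ereal (bregman h \<nu> (\<mu> t)))
          (\<lambda>\<nu>. 0 \<le> \<nu>) (\<mu> (t + 1))" if "t \<in> {1..T}" for t
    using run that unfolding dual_mirror_descent_run_def b_def g_def by blast
  have xt: "xt t \<in> actions (\<gamma> t)" if "t \<in> {1..T}" for t
    using steps[OF that] by (simp add: is_arg_max_def)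
  have x: "x t \<in> actions (\<gamma> t)" if "t \<in> {1..T}" for t
    using steps[OF that] xt[OF that] bounded_requestsD(1)[OF bounded] S that by auto
  have y: "y t \<in> actions (\<gamma> t)" if "t \<in> {1..T}" for t
    using feas that by (simp add: feasible_def)
  have zero: "consumption (\<gamma> t) 0 = 0" if "t \<in> {1..T}" for t
    using valid S that by (auto simp: valid_request_def split_beta)
  have b: "0 \<le> b t $ j" "b t $ j \<le> bbar" if "t \<in> {1..T}" for t j
    unfolding b_def using bounded_requestsD(4,5)[OF bounded _ xt[OF that]] S that by auto
  have \<mu>_Suc: "0 \<le> \<mu> (t + 1)" if "t \<in> {1..T}" for t
    using steps[OF that] by (simp add: is_arg_min_def)
  have \<mu>: "0 \<le> \<mu> t" if "t \<in> {1..T}" for t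
  proof (cases "t = 1")
    case True
    then show ?thesis using \<mu>1 \<open>0 \<le> \<mu>init\<close> by simp
  next
    case False
    then have "t - 1 \<in> {1..T}" "t - 1 + 1 = t" using that by auto
    then show ?thesis using \<mu>_Suc[of "t - 1"] by metis
  qed
  have min: "g t \<bullet> \<mu> (t + 1) + bregman h (\<mu> (t + 1)) (\<mu> t) / \<eta> \<le> g t \<bullet> \<nu> + bregman h \<nu> (\<mu> t) / \<eta>"
    if "t \<in> {1..T}" "0 \<le> \<nu>" for t \<nu>
  proof -
    \<comment> \<open>For positive \<eta> the extended-real weight is finite, and minimality becomes
      an inequality between reals.\<close>
    have inv: "1 / ereal \<eta> = ereal (1 / \<eta>)" using \<open>0 < \<eta>\<close> by (simp add: one_ereal_def)
    have "\<not> ereal (g t \<bullet> \<nu>) + 1 / ereal \<eta> * ereal (bregman h \<nu> (\<mu> t))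
        < ereal (g t \<bullet> \<mu> (t + 1)) + 1 / ereal \<eta> * ereal (bregman h (\<mu> (t + 1)) (\<mu> t))"
      using steps[OF that(1)] that(2) unfolding is_arg_min_def by blast
    then show ?thesis unfolding inv by simp
  qed
  have G: "\<bar>g t $ j\<bar> \<le> G" if "t \<in> {1..T}" for t j
  proof -
    have "\<rho> $ j \<le> Max (range (\<lambda>j. \<rho> $ j))" by (intro Max_ge) auto
    then show ?thesis using b[OF that, of j] \<rho>[rule_format, of j] 
      unfolding g_def G_def vector_minus_component by linarith
  qed
  \<comment> \<open>Since \<open>\<tau>\<close> counts tentative consumption, either the horizon is
    reached or step \<open>Suc \<tau>\<close> would overdraw some resource.\<close>
  obtain \<tau> where "\<tau> \<le> T" and within: "\<forall>t\<le>\<tau>. (\<Sum>s=1..t. b s) \<le> real T *\<^sub>R \<rho>"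
    and stop: "\<tau> = T \<or> \<not> (\<Sum>s=1..Suc \<tau>. b s) \<le> real T *\<^sub>R \<rho>"
    using \<rho> by (rule_tac last_before_violation[of "\<lambda>t. (\<Sum>s=1..t. b s) \<le> real T *\<^sub>R \<rho>" T])
      (auto simp: less_eq_vec_def less_imp_le)
  have uncurtailed: "x t = xt t" if "t \<in> {1..\<tau>}" for t
    using run_uncurtailed[OF run \<open>\<tau> \<le> T\<close>] within that unfolding b_def by blast
  have split: "(\<Sum>t=1..T. u t) = (\<Sum>t=1..\<tau>. u t) + (\<Sum>t=Suc \<tau>..T. u t)" for u :: "nat \<Rightarrow> real"
    using sum.ub_add_nat[of 1 \<tau> u "T - \<tau>"] \<open>\<tau> \<le> T\<close> by simp
  have before: "(\<Sum>t=1..\<tau>. reward (\<gamma> t) (y t) - \<alpha> * reward (\<gamma> t) (x t)) \<le> (\<Sum>t=1..\<tau>. \<alpha> * (g t \<bullet> \<mu> t))"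
  proof (rule sum_mono)
    fix t assume t: "t \<in> {1..\<tau>}"
    then have T: "t \<in> {1..T}" using \<open>\<tau> \<le> T\<close> by auto
    show "reward (\<gamma> t) (y t) - \<alpha> * reward (\<gamma> t) (x t) \<le> \<alpha> * (g t \<bullet> \<mu> t)"
      unfolding uncurtailed[OF t] \<alpha>_def g_def b_def
      using S T steps[OF T] by (intro run_reward_ge[OF \<rho> bounded _ \<mu>[OF T] _ zero[OF T] y[OF T]]) auto
  qed
  \<comment> \<open>After \<open>\<tau>\<close> the algorithm is only credited with nonnegative
    reward, so each step loses at most \<open>fbar\<close>.\<close>
  have after: "(\<Sum>t=Suc \<tau>..T. reward (\<gamma> t) (y t) - \<alpha> * reward (\<gamma> t) (x t)) \<le> (\<Sum>t=Suc \<tau>..T. fbar)"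
  proof (rule sum_mono)
    fix t assume "t \<in> {Suc \<tau>..T}"
    then have T: "t \<in> {1..T}" by auto
    have "0 \<le> \<alpha> * reward (\<gamma> t) (x t)"
      using bounded_requestsD(2)[OF bounded _ x[OF T]] S T \<open>1 \<le> \<alpha>\<close> by simp
    then show "reward (\<gamma> t) (y t) - \<alpha> * reward (\<gamma> t) (x t) \<le> fbar"
      using bounded_requestsD(3)[OF bounded _ y[OF T]] S T by force
  qed
  have "total_reward T \<gamma> y - \<alpha> * total_reward T \<gamma> x
      = (\<Sum>t=1..T. reward (\<gamma> t) (y t) - \<alpha> * reward (\<gamma> t) (x t))"
    by (simp add: total_reward_def sum_subtractf sum_distrib_left)
  also have "\<dots> \<le> (\<Sum>t=1..\<tau>. \<alpha> * (g t \<bullet> \<mu> t)) + fbar * (real T - real \<tau>)"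
    using before after \<open>\<tau> \<le> T\<close> unfolding split by (simp add: of_nat_diff mult.commute)
  finally have gap: "total_reward T \<gamma> y - \<alpha> * total_reward T \<gamma> x
      \<le> \<alpha> * (\<Sum>t=1..\<tau>. g t \<bullet> \<mu> t) + fbar * (real T - real \<tau>)"
    by (simp add: sum_distrib_left)
  have "\<exists>\<nu>\<ge>0. \<alpha> *\<^sub>R \<nu> \<in> insert 0 (range (\<lambda>j. (fbar / \<rho> $ j) *\<^sub>R axis j 1)) \<and>
      (\<Sum>t=1..\<tau>. g t \<bullet> (\<alpha> *\<^sub>R \<nu>)) + fbar * (real T - real \<tau>) \<le> fbar * bbar / \<rho>min"
  proof (cases "\<tau> = T")
    case True
    then show ?thesis
      using \<open>0 \<le> fbar\<close> \<open>0 \<le> bbar\<close> \<open>0 < \<rho>min\<close> by (intro exI[of _ 0]) simp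
  next
    case False
    then have T: "Suc \<tau> \<in> {1..T}" using \<open>\<tau> \<le> T\<close> by simp
    obtain j where "real T * \<rho> $ j < (\<Sum>s=1..Suc \<tau>. b s) $ j"
      using stop False by (auto simp: less_eq_vec_def not_le)
    then have "real T * \<rho> $ j < (\<Sum>s=1..\<tau>. b s $ j) + b (Suc \<tau>) $ j" by simp
    \<comment> \<open>The overdraft happens in one step, which consumes at most \<open>bbar\<close>;
      up to \<open>\<tau>\<close> all but \<open>bbar\<close> of resource \<open>j\<close> is
      therefore used.\<close>
    then have depleted: "real T * \<rho> $ j \<le> (\<Sum>s=1..\<tau>. b s $ j) + bbar"
      using b(2)[OF T, of j] by linarith
    \<comment> \<open>At price \<open>fbar / \<rho> $ j\<close> one period's share of resource
      \<open>j\<close> is worth \<open>fbar\<close>, which offsets the loss of one later period.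
      Dividing by \<alpha> compensates the factor \<alpha> in front of the regret.\<close>
    define \<nu> :: "real ^ 'm" where "\<nu> = (fbar / \<rho> $ j / \<alpha>) *\<^sub>R axis j 1"
    have \<alpha>\<nu>: "\<alpha> *\<^sub>R \<nu> = (fbar / \<rho> $ j) *\<^sub>R axis j 1" using \<open>1 \<le> \<alpha>\<close> by (simp add: \<nu>_def)
    have "0 < \<rho> $ j" using \<rho> by blast
    then have "0 \<le> \<nu>" using \<open>0 \<le> fbar\<close> \<open>1 \<le> \<alpha>\<close> by (auto simp: \<nu>_def less_eq_vec_def axis_def)
    have "(\<Sum>t=1..\<tau>. g t \<bullet> (\<alpha> *\<^sub>R \<nu>)) = fbar / \<rho> $ j * (real \<tau> * \<rho> $ j - (\<Sum>s=1..\<tau>. b s $ j))"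
    proof -
      have "(\<Sum>t=1..\<tau>. g t \<bullet> (\<alpha> *\<^sub>R \<nu>)) = (\<Sum>t=1..\<tau>. fbar / \<rho> $ j * (\<rho> $ j - b t $ j))"
        unfolding \<alpha>\<nu> by (simp add: inner_axis g_def)
      then show ?thesis by (simp add: sum_subtractf flip: sum_distrib_left sum_divide_distrib)
    qed
    also have "\<dots> \<le> fbar / \<rho> $ j * (real \<tau> * \<rho> $ j - real T * \<rho> $ j + bbar)"
      using depleted \<open>0 \<le> fbar\<close> \<open>0 < \<rho> $ j\<close> by (intro mult_left_mono) auto
    also have "\<dots> = fbar * bbar / \<rho> $ j - fbar * (real T - real \<tau>)"
      using \<open>0 < \<rho> $ j\<close> by (simp add: field_simps)
    also have "fbar * bbar / \<rho> $ j \<le> fbar * bbar / \<rho>min"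
      using \<open>0 \<le> fbar\<close> \<open>0 \<le> bbar\<close> \<open>0 < \<rho>min\<close> \<rho>min by (intro frac_le) auto
    finally show ?thesis using \<open>0 \<le> \<nu>\<close> \<alpha>\<nu> by (intro exI[of _ \<nu>]) auto
  qed
  then obtain \<nu> where "0 \<le> \<nu>"
    and \<nu>: "\<alpha> *\<^sub>R \<nu> \<in> insert 0 (range (\<lambda>j. (fbar / \<rho> $ j) *\<^sub>R axis j 1))"
    and comparator: "(\<Sum>t=1..\<tau>. g t \<bullet> (\<alpha> *\<^sub>R \<nu>)) + fbar * (real T - real \<tau>) \<le> fbar * bbar / \<rho>min"
    by blast
  have "(\<Sum>t=1..\<tau>. g t \<bullet> (\<mu> t - \<nu>)) \<le> real \<tau> * K + bregman h \<nu> \<mu>init / \<eta>"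
    unfolding K_def \<mu>1[symmetric]
    using \<open>0 \<le> \<mu>init\<close>[folded \<mu>1] diff[folded \<mu>1] \<mu>_Suc min G \<open>\<tau> \<le> T\<close>
    by (intro mirror_descent_regret[OF ref \<open>0 < \<eta>\<close> _ \<open>0 \<le> \<nu>\<close>, where T = T]) auto
  \<comment> \<open>The regret runs only up to \<open>\<tau>\<close>; as \<open>K\<close> is
    nonnegative, it may be extended to \<open>T\<close>.\<close>
  moreover have "real \<tau> * K \<le> real T * K"
    using \<open>\<tau> \<le> T\<close> \<open>0 < \<eta>\<close> \<open>0 < \<sigma>\<close> by (intro mult_right_mono) (auto simp: K_def)
  ultimately have "\<alpha> * (\<Sum>t=1..\<tau>. g t \<bullet> (\<mu> t - \<nu>)) \<le> \<alpha> * (real T * K + bregman h \<nu> \<mu>init / \<eta>)"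
    using \<open>1 \<le> \<alpha>\<close> by (intro mult_left_mono) auto
  moreover have "\<alpha> * bregman h \<nu> \<mu>init / \<eta> \<le> C3 / \<eta>"
    using C3 \<nu> \<open>0 < \<eta>\<close> by (intro divide_right_mono) (auto simp: \<alpha>_def)
  moreover have "\<alpha> * (\<Sum>t=1..\<tau>. g t \<bullet> (\<mu> t - \<nu>))
      = \<alpha> * (\<Sum>t=1..\<tau>. g t \<bullet> \<mu> t) - (\<Sum>t=1..\<tau>. g t \<bullet> (\<alpha> *\<^sub>R \<nu>))"
    by (simp add: inner_diff_right sum_subtractf sum_distrib_left right_diff_distrib)
  ultimately have "total_reward T \<gamma> y - \<alpha> * total_reward T \<gamma> x
      \<le> fbar * bbar / \<rho>min + \<alpha> * (real T * K) + C3 / \<eta>"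
    using gap comparator by (simp add: distrib_left)
  moreover have "\<alpha> * (real T * K) = \<alpha> * G\<^sup>2 / (2 * \<sigma>) * \<eta> * real T"
    by (simp add: K_def)
  ultimately show ?thesis by (simp only: \<alpha>_def \<rho>min_def G_def)
qed

section \<open>Supremum over offline solutions and the case of step size zero\<close>

lemma OPT_le:
  assumes "\<forall>r\<in>S. valid_request r" "\<forall>j. 0 < \<rho> $ j" "\<forall>t\<in>{1..T}. \<gamma> t \<in> S"
    and "\<And>y. feasible T \<rho> \<gamma> y \<Longrightarrow> total_reward T \<gamma> y \<le> c"
  shows "OPT T \<rho> \<gamma> \<le> c"
proof -
  have "0 \<in> actions (\<gamma> t) \<and> consumption (\<gamma> t) 0 = 0" if "t \<in> {1..T}" for t
    using assms(1,3) that by (auto simp: valid_request_def split_beta)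
  \<comment> \<open>The zero plan makes the set nonempty, so a bound on all its values passes to the
    supremum.\<close>
  then have "feasible T \<rho> \<gamma> (\<lambda>t. 0)"
    using assms(2) by (auto simp: feasible_def less_eq_vec_def less_imp_le)
  then show ?thesis
    unfolding OPT_def using assms(4) by (intro cSUP_least) auto
qed

text \<open>Extended reals give \<open>C3 / \<eta>\<close> a meaning at \<eta> = 0.
  Differentiability at \<open>\<mu>init\<close> ensures that the divergences in \<open>C3\<close>
  are formed with a genuine gradient.\<close>

theorem theorem2:
  fixes S :: "('d::finite, 'm::finite) request set"
    and \<rho> \<mu>init :: "real ^ 'm"
    and fbar bbar \<sigma> \<eta> :: real
    and h :: "real ^ 'm \<Rightarrow> real"
    and T :: nat
    and \<gamma> :: "nat \<Rightarrow> ('d, 'm) request"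
    and xt x :: "nat \<Rightarrow> real ^ 'd"
    and B \<mu> :: "nat \<Rightarrow> real ^ 'm"
  assumes "\<forall>j. 0 < \<rho> $ j"
    and "\<forall>r\<in>S. valid_request r"
    and "bounded_requests S fbar bbar"
    and "reference_function \<sigma> h"
    and "0 \<le> \<eta>"
    and "0 \<le> \<mu>init"
    and "h differentiable (at \<mu>init within {0..})"
    and "1 \<le> T"
    and "\<forall>t\<in>{1..T}. \<gamma> t \<in> S"
    and "dual_mirror_descent_run T \<rho> h \<eta> \<mu>init \<gamma> xt x B \<mu>"
  shows
    "let \<alpha> = alpha_star S \<rho>;
         C1 = fbar * bbar / Min (range (\<lambda>j. \<rho> $ j));
         C2 = \<alpha> * (bbar + Max (range (\<lambda>j. \<rho> $ j)))\<^sup>2 / (2 * \<sigma>);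
         C3 = Max ((\<lambda>\<nu>. \<alpha> * bregman h \<nu> \<mu>init) `
                {\<nu>. \<alpha> *\<^sub>R \<nu> \<in> insert 0 (range (\<lambda>j. (fbar / \<rho> $ j) *\<^sub>R axis j 1))})
     in ereal (OPT T \<rho> \<gamma> - \<alpha> * total_reward T \<gamma> x)
          \<le> ereal (C1 + C2 * \<eta> * real T) + ereal C3 / ereal \<eta>"
proof -
  define \<alpha> where "\<alpha> = alpha_star S \<rho>"
  define N :: "(real ^ 'm) set" where "N = {\<nu>. \<alpha> *\<^sub>R \<nu> \<in> insert 0 (range (\<lambda>j. (fbar / \<rho> $ j) *\<^sub>R axis j 1))}"
  define C1 where "C1 = fbar * bbar / Min (range (\<lambda>j. \<rho> $ j))"
  define C2 where "C2 = \<alpha> * (bbar + Max (range (\<lambda>j. \<rho> $ j)))\<^sup>2 / (2 * \<sigma>)"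
  define C3 where "C3 = Max ((\<lambda>\<nu>. \<alpha> * bregman h \<nu> \<mu>init) ` N)"
  note \<rho> = assms(1) and bounded = assms(3) and ref = assms(4)
  have "1 \<le> \<alpha>" by (simp add: \<alpha>_def alpha_star_ge_1)
  have "0 \<le> fbar" "0 \<le> bbar" using bounded by (auto simp: bounded_requests_def)
  \<comment> \<open>\<open>N\<close> is the preimage of a finite set under an injective scaling, so
    \<open>C3\<close> is a true maximum.\<close>
  have "finite N"
    unfolding N_def using \<open>1 \<le> \<alpha>\<close>
    by (intro finite_vimageI[of _ "(*\<^sub>R) \<alpha>", unfolded vimage_def]) (auto intro: injI)
  then have C3: "\<alpha> * bregman h \<nu> \<mu>init \<le> C3" if "\<nu> \<in> N" for \<nu>
    unfolding C3_def using that by (intro Max_ge) auto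
  have "ereal (OPT T \<rho> \<gamma> - \<alpha> * total_reward T \<gamma> x)
      \<le> ereal (C1 + C2 * \<eta> * real T) + ereal C3 / ereal \<eta>"
  proof (cases "\<eta> = 0")
    case False
    then have "0 < \<eta>" using assms(5) by simp
    have "total_reward T \<gamma> y \<le> C1 + C2 * \<eta> * real T + C3 / \<eta> + \<alpha> * total_reward T \<gamma> x"
      if "feasible T \<rho> \<gamma> y" for y
      using run_competitive[OF \<rho> assms(2) bounded ref \<open>0 < \<eta>\<close> assms(6,7,9,10) that, of C3] C3
      unfolding C1_def C2_def \<alpha>_def N_def by force
    then have "OPT T \<rho> \<gamma> \<le> C1 + C2 * \<eta> * real T + C3 / \<eta> + \<alpha> * total_reward T \<gamma> x"
      by (rule OPT_le[OF assms(2,1,9)])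
    then show ?thesis using \<open>0 < \<eta>\<close> by simp
  next
    \<comment> \<open>The right-hand side is \<open>\<infinity>\<close> unless \<open>C3 = 0\<close>, where \<open>0 / 0 = 0\<close>; but \<open>C3 = 0\<close> forces
      \<open>fbar = 0\<close>, as \<open>\<mu>init\<close> is the only zero of the divergence.\<close>
    case eta: True
    show ?thesis
    proof (cases "0 < C3")
      case True
      then show ?thesis using eta by (simp add: divide_ereal_def)
    next
      case False
      have "\<nu> = \<mu>init" if "\<nu> \<in> N" "0 \<le> \<nu>" for \<nu>
      proof (rule bregman_eq_0[OF ref that(2) assms(6,7)])
        have "\<alpha> * bregman h \<nu> \<mu>init \<le> 0" using C3[OF that(1)] False by linarith
        then show "bregman h \<nu> \<mu>init \<le> 0" using \<open>1 \<le> \<alpha>\<close> by (simp add: mult_le_0_iff)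
      qed
      moreover have "0 \<in> N" by (simp add: N_def)
      ultimately have only_zero: "\<nu> = 0" if "\<nu> \<in> N" "0 \<le> \<nu>" for \<nu> using that by (metis order_refl)
      \<comment> \<open>Any resource serves here; index types are nonempty.\<close>
      define j :: 'm where "j = undefined"
      have "0 < \<rho> $ j" using \<rho> by blast
      define \<nu> :: "real ^ 'm" where "\<nu> = (fbar / \<rho> $ j / \<alpha>) *\<^sub>R axis j 1"
      have "\<nu> \<in> N" using \<open>1 \<le> \<alpha>\<close> by (simp add: \<nu>_def N_def)
      have "0 \<le> \<nu>"
        using \<open>0 \<le> fbar\<close> \<open>1 \<le> \<alpha>\<close> \<open>0 < \<rho> $ j\<close> by (auto simp: \<nu>_def less_eq_vec_def axis_def)
      with \<open>\<nu> \<in> N\<close> have "\<nu> = 0" by (rule only_zero)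
      then have "fbar = 0"
        using \<open>1 \<le> \<alpha>\<close> \<open>0 < \<rho> $ j\<close> by (simp add: \<nu>_def axis_eq_0_iff)
      have "0 \<le> \<alpha> * bregman h 0 \<mu>init"
        using bregman_nonneg[OF ref _ assms(6,7), of 0] \<open>1 \<le> \<alpha>\<close> by simp
      then have "C3 = 0" using C3[OF \<open>0 \<in> N\<close>] False by linarith
      have "total_reward T \<gamma> y \<le> 0" if "feasible T \<rho> \<gamma> y" for y
        unfolding total_reward_def using bounded_requestsD(3)[OF bounded] assms(9) that \<open>fbar = 0\<close>
        by (intro sum_nonpos) (auto simp: feasible_def)
      then have "OPT T \<rho> \<gamma> \<le> 0" by (rule OPT_le[OF assms(2,1,9)])
      moreover have "0 \<le> total_reward T \<gamma> x"
        unfolding total_reward_def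
      proof (rule sum_nonneg)
        fix t assume t: "t \<in> {1..T}"
        have "is_arg_max (\<lambda>y. reward (\<gamma> t) y - \<mu> t \<bullet> consumption (\<gamma> t) y)
              (\<lambda>y. y \<in> actions (\<gamma> t)) (xt t) \<and>
            x t = (if consumption (\<gamma> t) (xt t) \<le> B t then xt t else 0)"
          using assms(10) t unfolding dual_mirror_descent_run_def by blast
        then have "x t \<in> actions (\<gamma> t)"
          using bounded_requestsD(1)[OF bounded] assms(9) t by (auto simp: is_arg_max_def)
        then show "0 \<le> reward (\<gamma> t) (x t)"
          using bounded_requestsD(2)[OF bounded] assms(9) t by blast
      qed
      then have "0 \<le> \<alpha> * total_reward T \<gamma> x" using \<open>1 \<le> \<alpha>\<close> by simp
      ultimately show ?thesis
        using eta \<open>C3 = 0\<close> \<open>fbar = 0\<close> by (simp add: C1_def divide_ereal_def flip: zero_ereal_def)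
    qed
  qed
  then show ?thesis
    unfolding Let_def C1_def C2_def C3_def N_def \<alpha>_def .
qed

end
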